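(* Let $S$ be an ALF space. The subsets of $S$ that are open in $S$ (i.e. that contain no element of their own frontier) satisfy the classical axioms of topology: (C1) $S$ and $\emptyset$ are open; (C2) the union of any number of open subsets is open; (C3) the intersection of a finite number of open subsets is open.
   Context: A locally finite (LF) space is a nonempty set $S$ such that to each element $e\in S$ certain finite subsets of $S$ are assigned as neighborhoods of $e$ (at least one for each $e$). An ALF space is an LF space satisfying Axioms 1–4: Axiom 1: each neighborhood of $e$ contains $e$, and the intersection of two neighborhoods of $e$ is a neighborhood of $e$. Hence each $e$ has a smallest neighborhood $SN(e)$, the intersection of all its neighborhoods. Axiom 2: there are elements $e$ for which $SN(e)$ has more than one element. Frontier: for $T\subseteq S$, $Fr(T,S)$ is the set of all $e\in S$ such that $SN(e)$ contains elements of both $T$ and $S\setminus T$ (so $Fr(\emptyset,S)=\emptyset$). Axiom 3: the frontier of every $T\subset S$ is thin, i.e. there is no pair $a,b\in Fr(T,S)$ with $a\in SN(b)$, $b\in SN(a)$, one in $T$ and the other in $S\setminus T$. Axiom 4: $Fr(Fr(T,S),S)=Fr(T,S)$ for every $T\subset S$. Open: a subset $O\subseteq S$ is open in $S$ if $O\cap Fr(O,S)=\emptyset$. *)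

theory Defs
  imports Main
begin

text \<open>
  \<open>N e\<close> is the family of all neighborhoods of \<open>e\<close>; only its values at points of the
  carrier \<open>S\<close> matter.
\<close>

locale LF_space =
  fixes S :: "'a set" and N :: "'a \<Rightarrow> 'a set set"
  assumes nonempty: "S \<noteq> {}"
    and nbhd_exists: "e \<in> S \<Longrightarrow> N e \<noteq> {}"
    and nbhd_subset: "e \<in> S \<Longrightarrow> U \<in> N e \<Longrightarrow> U \<subseteq> S"
    and nbhd_finite: "e \<in> S \<Longrightarrow> U \<in> N e \<Longrightarrow> finite U"

definition SN :: "('a \<Rightarrow> 'a set set) \<Rightarrow> 'a \<Rightarrow> 'a set" where
  "SN N e = \<Inter> (N e)"

definition Fr :: "('a \<Rightarrow> 'a set set) \<Rightarrow> 'a set \<Rightarrow> 'a set \<Rightarrow> 'a set" where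
  "Fr N T S = {e \<in> S. SN N e \<inter> T \<noteq> {} \<and> SN N e \<inter> (S - T) \<noteq> {}}"

text \<open>The conditions on \<open>a\<close> and \<open>b\<close> other than the last two are symmetric, so it is no
  restriction to let \<open>a\<close> be the one in \<open>T\<close>.\<close>

definition thin_Fr :: "('a \<Rightarrow> 'a set set) \<Rightarrow> 'a set \<Rightarrow> 'a set \<Rightarrow> bool" where
  "thin_Fr N T S \<longleftrightarrow>
    \<not> (\<exists>a\<in>Fr N T S. \<exists>b\<in>Fr N T S. a \<in> SN N b \<and> b \<in> SN N a \<and> a \<in> T \<and> b \<in> S - T)"

locale ALF_space = LF_space +
  assumes axiom1_mem: "e \<in> S \<Longrightarrow> U \<in> N e \<Longrightarrow> e \<in> U"
    and axiom1_Int: "e \<in> S \<Longrightarrow> U \<in> N e \<Longrightarrow> V \<in> N e \<Longrightarrow> U \<inter> V \<in> N e"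
    and axiom2: "\<exists>e\<in>S. \<exists>x\<in>SN N e. \<exists>y\<in>SN N e. x \<noteq> y"
    and axiom3: "T \<subseteq> S \<Longrightarrow> thin_Fr N T S"
    and axiom4: "T \<subseteq> S \<Longrightarrow> Fr N (Fr N T S) S = Fr N T S"

definition ALF_open :: "('a \<Rightarrow> 'a set set) \<Rightarrow> 'a set \<Rightarrow> 'a set \<Rightarrow> bool" where
  "ALF_open N U S \<longleftrightarrow> U \<subseteq> S \<and> U \<inter> Fr N U S = {}"

end

theory Submission
  imports Defs
begin

text \<open>
  Since \<open>e\<close> lies in its own smallest neighborhood, a point \<open>e\<close> of \<open>U\<close> is outside the frontier
  of \<open>U\<close> exactly when its smallest neighborhood stays inside \<open>U\<close>. So open sets are those closed
  under smallest neighborhoods, a property preserved by arbitrary unions and intersections.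
\<close>

context ALF_space
begin

lemma SN_self: "e \<in> S \<Longrightarrow> e \<in> SN N e"
  using axiom1_mem by (auto simp: SN_def)

text \<open>Some neighborhood of \<open>e\<close> exists, so the intersection is not the empty one,
  which would be \<open>UNIV\<close>, and it lies inside a subset of \<open>S\<close>.\<close>

lemma SN_subset: "e \<in> S \<Longrightarrow> SN N e \<subseteq> S"
  using nbhd_exists nbhd_subset by (fastforce simp: SN_def)

text \<open>\<open>Fr\<close> tests only against \<open>S - U\<close>; \<open>SN_subset\<close>
  turns missing that set into inclusion in \<open>U\<close>.\<close>

lemma ALF_open_iff: "ALF_open N U S \<longleftrightarrow> U \<subseteq> S \<and> (\<forall>e\<in>U. SN N e \<subseteq> U)"
  using SN_self SN_subset unfolding ALF_open_def Fr_def by blast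

lemma ALF_open_carrier: "ALF_open N S S"
  using SN_subset by (simp add: ALF_open_iff)

lemma ALF_open_empty: "ALF_open N {} S"
  by (simp add: ALF_open_iff)

lemma ALF_open_Union: "(\<And>U. U \<in> \<U> \<Longrightarrow> ALF_open N U S) \<Longrightarrow> ALF_open N (\<Union>\<U>) S"
  unfolding ALF_open_iff by blast

text \<open>Any member of the family bounds the intersection by \<open>S\<close>; over the empty
  family it would be \<open>UNIV\<close>.\<close>

lemma ALF_open_Inter: "\<U> \<noteq> {} \<Longrightarrow> (\<And>U. U \<in> \<U> \<Longrightarrow> ALF_open N U S) \<Longrightarrow> ALF_open N (\<Inter>\<U>) S"
  unfolding ALF_open_iff by blast

end

theorem mainTheorem4:
  fixes S :: "'a set" and N :: "'a \<Rightarrow> 'a set set"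
  assumes "ALF_space S N"
  shows "(ALF_open N S S \<and> ALF_open N {} S)
    \<and> (\<forall>\<U>. (\<forall>U\<in>\<U>. ALF_open N U S) \<longrightarrow> ALF_open N (\<Union>\<U>) S)
    \<and> (\<forall>\<U>. finite \<U> \<and> \<U> \<noteq> {} \<and> (\<forall>U\<in>\<U>. ALF_open N U S) \<longrightarrow> ALF_open N (\<Inter>\<U>) S)"
proof -
  interpret ALF_space S N by fact
  show ?thesis
    using ALF_open_carrier ALF_open_empty ALF_open_Union ALF_open_Inter by simp
qed

end
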